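(* Let $q\ge2$ and $\rho\le(2q)^{-1.5}$ (with $\rho\ge0$). Let $\mathbf{Z}_1,\dots,\mathbf{Z}_n$ be independent real random variables with $\mathbb{E}[\mathbf{Z}_i]=0$, $\mathbb{E}[\mathbf{Z}_i^2]=1$, and let $\sigma_i>0$ satisfy $\mathbb{E}[|\mathbf{Z}_i|^q]=\sigma_i^{2-q}$. Let $f=\sum_{S\subseteq[n]}a_S\prod_{i\in S}\mathbf{Z}_i$ with real $a_S$. Then \[\|\mathrm{T}_\rho f\|_q^q\le\sum_{S\subseteq[n]}\sigma_S^{2-q}\|\mathrm{D}_S[f]\|_2^q,\] where $\sigma_S=\prod_{i\in S}\sigma_i$.
   Context: For $f=\sum_S a_S\prod_{i\in S}\mathbf{Z}_i$: $\mathrm{T}_\rho f=\sum_S\rho^{|S|}a_S\prod_{i\in S}\mathbf{Z}_i$ and $\mathrm{D}_T[f]=\sum_{S\supseteq T}a_S\prod_{i\in S\setminus T}\mathbf{Z}_i$. Norms are $L^r$ norms of random variables. *)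

theory Defs
  imports "HOL-Probability.Probability"
begin

text \<open>
  A multilinear polynomial f in the random variables Z i, for i in the finite index set I, is given
  by its coefficient family a, where a S is the coefficient of the monomial of S, for S a subset
  of I. The operators T and D act on f through these coefficients.
\<close>

definition multilin :: "'i set \<Rightarrow> ('i \<Rightarrow> 'w \<Rightarrow> real) \<Rightarrow> ('i set \<Rightarrow> real) \<Rightarrow> 'w \<Rightarrow> real" where
  "multilin I Z a = (\<lambda>x. \<Sum>S\<in>Pow I. a S * (\<Prod>i\<in>S. Z i x))"

definition T_op :: "'i set \<Rightarrow> ('i \<Rightarrow> 'w \<Rightarrow> real) \<Rightarrow> real \<Rightarrow> ('i set \<Rightarrow> real) \<Rightarrow> 'w \<Rightarrow> real" where
  "T_op I Z \<rho> a = multilin I Z (\<lambda>S. \<rho> ^ card S * a S)"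

definition D_op :: "'i set \<Rightarrow> ('i \<Rightarrow> 'w \<Rightarrow> real) \<Rightarrow> 'i set \<Rightarrow> ('i set \<Rightarrow> real) \<Rightarrow> 'w \<Rightarrow> real" where
  "D_op I Z T a = (\<lambda>x. \<Sum>S\<in>{S. T \<subseteq> S \<and> S \<subseteq> I}. a S * (\<Prod>i\<in>S - T. Z i x))"

text \<open>
  The norm of the Lebesgue space with exponent r. It has this meaning only if the r-th power of
  the absolute value of X is integrable; otherwise the Bochner integral, and so the value here, is 0.
\<close>

definition Lr_norm :: "'w measure \<Rightarrow> real \<Rightarrow> ('w \<Rightarrow> real) \<Rightarrow> real" where
  "Lr_norm M r X = (LINT x|M. \<bar>X x\<bar> powr r) powr (1 / r)"

end

theory Submission
  imports Defs
begin

text \<open>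
  The inequality is strengthened to vector-valued coefficients so that it tensorizes. For one
  variable and vectors d, e it reads
  E |d + rho Z e|^q \<le> (|d|^2 + |e|^2)^(q/2) + E|Z|^q |e|^q, which follows by taking expectations in a
  pointwise second-order expansion of |d + rho Z e|^q: the linear term vanishes, the quadratic
  term is absorbed by Bernoulli's inequality and the remainder by the bound on rho.
  Splitting off one variable turns a coefficient family a into the pair of a S and
  a (insert i S), S not containing i. The first term above applies the induction hypothesis to this
  pair as a longer vector and yields the summands for S not containing i; the second term yields
  those for S containing i. Finally, orthonormality of the monomials identifies the squared
  2-norm of D_S f with the sum of the squares of a U over U containing S.
\<close>

section \<open>Scalar inequalities behind the pointwise expansion\<close>

lemma exp_le_quadratic:
  fixes x :: real
  assumes "\<bar>x\<bar> \<le> 1"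
  shows "exp x \<le> 1 + x + x\<^sup>2"
proof (cases "0 \<le> x")
  case True
  then show ?thesis using assms exp_bound by auto
next
  case False
  define y where "y = - x"
  have y: "0 < y" "y \<le> 1" using False assms by (auto simp: y_def)
  \<comment> \<open>The product equals 1 + y^3. Together with 1 + y \<le> exp y this bounds exp (-y)
    from above.\<close>
  have "1 \<le> (1 + y) * (1 - y + y\<^sup>2)"
    using y by (simp add: algebra_simps power2_eq_square)
  also have "\<dots> \<le> exp y * (1 - y + y\<^sup>2)"
    using y by (intro mult_right_mono exp_ge_add_one_self) (auto simp: add_nonneg_nonneg)
  finally have "inverse (exp y) \<le> 1 - y + y\<^sup>2"
    by (simp add: field_simps)
  then show ?thesis by (simp add: y_def exp_minus)
qed

lemma one_plus_powr_ge:
  fixes x p :: real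
  assumes "0 \<le> x" "1 \<le> p"
  shows "1 + p * x \<le> (1 + x) powr p"
proof -
  have "(1 + 0) powr p - p * 0 \<le> (1 + x) powr p - p * x"
  proof (rule DERIV_nonneg_imp_nondecreasing[OF assms(1)])
    fix t :: real assume t: "0 \<le> t" "t \<le> x"
    have "((\<lambda>t. (1 + t) powr p - p * t) has_real_derivative p * (1 + t) powr (p - 1) - p) (at t)"
      using t by (auto intro!: derivative_eq_intros)
    moreover have "0 \<le> p * (1 + t) powr (p - 1) - p"
      using t assms ge_one_powr_ge_zero[of "1 + t" "p - 1"] by simp
    ultimately show "\<exists>y. ((\<lambda>t. (1 + t) powr p - p * t) has_real_derivative y) (at t) \<and> 0 \<le> y"
      by blast
  qed
  then show ?thesis by simp
qed

text \<open>Divide by A^q and apply Bernoulli's inequality with exponent q/2 to B^2/A^2. The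
  coefficient q/2 gained here is the room into which the quadratic term of the expansion must
  fit.\<close>

lemma powr_half_sum_squares_ge:
  fixes A B q :: real
  assumes q: "2 \<le> q" and "0 \<le> A"
  shows "A powr q + q / 2 * A powr (q - 2) * B\<^sup>2 \<le> (A\<^sup>2 + B\<^sup>2) powr (q / 2)"
proof (cases "A = 0")
  case False
  then have A: "0 < A" using assms by simp
  have Aq: "(A\<^sup>2) powr (q / 2) = A powr q" "A powr q = A powr (q - 2) * A\<^sup>2"
    using A by (simp_all add: powr_powr powr_add[symmetric] flip: powr_numeral)
  have "A powr q + q / 2 * A powr (q - 2) * B\<^sup>2 = A powr q * (1 + q / 2 * (B\<^sup>2 / A\<^sup>2))"
    using A by (simp add: Aq(2) field_simps)
  also have "\<dots> \<le> A powr q * (1 + B\<^sup>2 / A\<^sup>2) powr (q / 2)"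
    using q by (intro mult_left_mono one_plus_powr_ge) auto
  also have "\<dots> = (A\<^sup>2 * (1 + B\<^sup>2 / A\<^sup>2)) powr (q / 2)"
    using A by (subst powr_mult) (auto simp: Aq add_nonneg_nonneg)
  also have "\<dots> = (A\<^sup>2 + B\<^sup>2) powr (q / 2)"
    using A by (simp add: distrib_left)
  finally show ?thesis .
\<comment> \<open>For \<open>A = 0\<close> the left side vanishes, at \<open>q = 2\<close> as well,
  because \<open>0 powr 0\<close> is 0.\<close>
qed (use q in auto)

text \<open>
  With \<open>A\<close>, \<open>B\<close> the lengths of two vectors and \<open>c\<close> their inner product, the base on the left is the
  squared length of their sum.
\<close>
lemma powr_half_expansion_le:
  fixes A B c q :: real
  assumes q: "2 \<le> q" and A: "0 \<le> A" and B: "0 \<le> B" and c: "\<bar>c\<bar> \<le> A * B"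
  shows "(A\<^sup>2 + 2 * c + B\<^sup>2) powr (q / 2)
    \<le> A powr q + q * c * A powr (q - 2) + 4 * q ^ 4 * B\<^sup>2 * A powr (q - 2)
      + (2 * q) powr (1.5 * q) * B powr q"
\<comment> \<open>If B is not small against A, the remainder term alone dominates the left side.
  Otherwise B/A < 1/(2q), and a Taylor-type bound around A applies.\<close>
proof (cases "A \<le> 2 * q * B")
  case True
  have W: "0 \<le> A\<^sup>2 + 2 * c + B\<^sup>2" "A\<^sup>2 + 2 * c + B\<^sup>2 \<le> (A + B)\<^sup>2"
    using c zero_le_power2[of "A - B"] by (auto simp: power2_eq_square algebra_simps)
  have "(A\<^sup>2 + 2 * c + B\<^sup>2) powr (q / 2) \<le> ((A + B)\<^sup>2) powr (q / 2)"
    using W q by (intro powr_mono2) auto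
  also have "\<dots> = (A + B) powr q"
  proof (cases "A + B = 0")
    case False
    then show ?thesis using A B by (simp add: powr_powr flip: powr_numeral)
  qed (use q in simp)
  \<comment> \<open>Both A and B are at most 2qB, so A + B \<le> 2q * 2B, and 2 \<le> (2q)^(1/2)
    since q \<ge> 2. This is the source of the exponent 1.5.\<close>
  also have "\<dots> \<le> ((2 * q) powr 1.5 * B) powr q"
  proof (intro powr_mono2)
    have "2 powr 1 * B \<le> (2 * q) powr (1/2) * B"
    proof (intro mult_right_mono)
      have "2 = 4 powr (1/2 :: real)" by (simp add: powr_half_sqrt)
      also have "\<dots> \<le> (2 * q) powr (1/2)" using q by (intro powr_mono2) auto
      finally show "2 powr 1 \<le> (2 * q) powr (1/2)" by simp
    qed (use B in auto)
    then have "2 * q * (2 * B) \<le> 2 * q * ((2 * q) powr (1/2) * B)"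
      using q by (intro mult_left_mono) auto
    also have "\<dots> = (2 * q) powr 1.5 * B"
      using q powr_add[of "2 * q" 1 "1/2"] by simp
    finally have "2 * q * (2 * B) \<le> (2 * q) powr 1.5 * B" .
    moreover have "B \<le> 2 * q * B"
      using q B mult_right_mono[of 1 "2 * q" B] by simp
    ultimately show "A + B \<le> (2 * q) powr 1.5 * B" using True by simp
  qed (use A B q in auto)
  also have "\<dots> = (2 * q) powr (1.5 * q) * B powr q"
    using q B by (subst powr_mult) (auto simp: powr_powr)
  finally have "(A\<^sup>2 + 2 * c + B\<^sup>2) powr (q / 2) \<le> (2 * q) powr (1.5 * q) * B powr q" .
  \<comment> \<open>The linear term may be negative, but |c| \<le> AB \<le> 2q B^2 \<le> 4q^3 B^2,
    so the quadratic term compensates for it.\<close>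
  moreover have "0 \<le> q * A powr (q - 2) * (c + 4 * q ^ 3 * B\<^sup>2)"
  proof -
    have "A * B \<le> 2 * q * B * B" using True B by (intro mult_right_mono)
    also have "\<dots> \<le> 4 * q ^ 3 * B\<^sup>2"
    proof -
      have "2 * 2 \<le> q * q" using q by (intro mult_mono) auto
      then have "q * 2 \<le> q * (4 * q\<^sup>2)"
        using q by (intro mult_left_mono) (auto simp: power2_eq_square)
      then have "2 * q * B\<^sup>2 \<le> 4 * q ^ 3 * B\<^sup>2"
        by (intro mult_right_mono) (auto simp: power3_eq_cube power2_eq_square)
      then show ?thesis by (simp add: power2_eq_square)
    qed
    finally have "0 \<le> c + 4 * q ^ 3 * B\<^sup>2" using c by linarith
    then show ?thesis using q by simp
  qed
  then have "0 \<le> q * c * A powr (q - 2) + 4 * q ^ 4 * B\<^sup>2 * A powr (q - 2)"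
    by (simp add: algebra_simps power4_eq_xxxx power3_eq_cube)
  ultimately show ?thesis using powr_ge_zero[of A q] by linarith
next
  case False
  then have A0: "0 < A" using A B q by (metis less_le mult_nonneg_nonneg not_le order_trans zero_le_numeral)
  \<comment> \<open>Dividing the squared length of the sum by A^2 gives 1 + x. Since q s \<le> 1/2
    and |x| \<le> 9/4 s, the exponent q/2 * x stays within [-1, 1], where
    \<open>exp_le_quadratic\<close> holds.\<close>
  define s where "s = B / A"
  define r where "r = c / A\<^sup>2"
  define x where "x = 2 * r + s\<^sup>2"
  have s: "0 \<le> s" "q * s \<le> 1 / 2" using False A0 B q by (auto simp: s_def field_simps)
  then have s4: "s \<le> 1 / 4" using q mult_right_mono[of 2 q s] by linarith
  have r: "\<bar>r\<bar> \<le> s"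
    using c A0 by (simp add: r_def s_def field_simps power2_eq_square abs_mult)
  have ss: "s\<^sup>2 \<le> s / 4" using s s4 mult_left_mono[of s "1/4" s] by (simp add: power2_eq_square)
  have x: "\<bar>x\<bar> \<le> 9 / 4 * s" unfolding x_def using r ss s zero_le_power2[of s] by linarith
  have W: "A\<^sup>2 + 2 * c + B\<^sup>2 = A\<^sup>2 * (1 + x)"
    using A0 by (simp add: x_def r_def s_def field_simps)
  have x0: "0 \<le> 1 + x" using x s4 by linarith
  have px: "\<bar>q / 2 * x\<bar> \<le> 9 / 8 * (q * s)"
    using q mult_left_mono[OF x, of "q / 2"] by (simp add: abs_mult)
  have "(1 + x) powr (q / 2) \<le> exp x powr (q / 2)"
    using x0 q exp_ge_add_one_self by (intro powr_mono2) auto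
  also have "\<dots> = exp (q / 2 * x)"
    by (simp add: powr_def)
  also have "\<dots> \<le> 1 + q / 2 * x + (q / 2 * x)\<^sup>2"
    using px s by (intro exp_le_quadratic) linarith
  also have "\<dots> \<le> 1 + q / 2 * x + (9 / 8 * (q * s))\<^sup>2"
    using px by (intro add_left_mono) (metis abs_ge_zero power2_abs power_mono)
  \<comment> \<open>The term q/2 * x contributes q r, the linear term, and q/2 * s^2. The latter
    joins the square, and q/2 + 81/64 q^2 \<le> 2 q^2 \<le> 4 q^4.\<close>
  also have "\<dots> \<le> 1 + q * r + 4 * q ^ 4 * s\<^sup>2"
  proof -
    have q2: "2 * 2 \<le> q * q" using q by (intro mult_mono) auto
    have "q / 2 + 81 / 64 * q\<^sup>2 \<le> 2 * q\<^sup>2" using q2 q mult_right_mono[of 2 q q] unfolding power2_eq_square by linarith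
    also have "\<dots> \<le> 4 * q ^ 4"
      using mult_mono[OF q2 order_refl, of "q * q"] q2 by (simp add: power2_eq_square power4_eq_xxxx mult.assoc)
    finally have "(q / 2 + 81 / 64 * q\<^sup>2) * s\<^sup>2 \<le> 4 * q ^ 4 * s\<^sup>2"
      by (intro mult_right_mono) auto
    then show ?thesis by (simp add: x_def algebra_simps power2_eq_square)
  qed
  finally have main: "(1 + x) powr (q / 2) \<le> 1 + q * r + 4 * q ^ 4 * s\<^sup>2" .
  have Aq: "(A\<^sup>2) powr (q / 2) = A powr q" "A powr q = A powr (q - 2) * A\<^sup>2"
    using A0 by (simp_all add: powr_powr powr_add[symmetric] flip: powr_numeral)
  have "(A\<^sup>2 + 2 * c + B\<^sup>2) powr (q / 2) = A powr q * (1 + x) powr (q / 2)"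
    unfolding W using x0 by (subst powr_mult) (auto simp: Aq)
  also have "\<dots> \<le> A powr q * (1 + q * r + 4 * q ^ 4 * s\<^sup>2)"
    using main by (intro mult_left_mono) auto
  also have "\<dots> = A powr q + q * c * A powr (q - 2) + 4 * q ^ 4 * B\<^sup>2 * A powr (q - 2)"
    using A0 by (simp add: Aq(2) r_def s_def field_simps)
  finally show ?thesis by (smt (verit) mult_nonneg_nonneg powr_ge_zero)
qed


section \<open>The inequality for one variable\<close>

text \<open>Here \<open>N\<close> is the law of one variable, \<open>A\<close> and \<open>B\<close>
  are the lengths of vectors d and e, and \<open>c\<close> is their inner product, so the integrand
  is |d + \<rho> y e|^q. Only these three numbers enter, so no vector space is needed.\<close>

lemma nn_integral_noise_le:
  fixes N :: "real measure" and A B c q \<rho> :: real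
  assumes N: "prob_space N" "sets N = sets borel"
    and q: "2 \<le> q" and \<rho>: "0 \<le> \<rho>" "\<rho> \<le> (2 * q) powr (- 1.5)"
    and mean: "integrable N (\<lambda>y. y)" "(LINT y|N. y) = 0"
    and variance: "integrable N (\<lambda>y. y\<^sup>2)" "(LINT y|N. y\<^sup>2) = 1"
    and moment: "integrable N (\<lambda>y. \<bar>y\<bar> powr q)"
    and A: "0 \<le> A" and B: "0 \<le> B" and c: "\<bar>c\<bar> \<le> A * B"
  shows "(\<integral>\<^sup>+ y. ennreal ((A\<^sup>2 + 2 * (\<rho> * y * c) + (\<rho> * y * B)\<^sup>2) powr (q / 2)) \<partial>N)
    \<le> ennreal ((A\<^sup>2 + B\<^sup>2) powr (q / 2) + (LINT y|N. \<bar>y\<bar> powr q) * B powr q)"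
proof -
  interpret prob_space N by fact
  \<comment> \<open>An integrable majorant. Its linear term has mean 0, and its quadratic
    coefficient is exactly the one in \<open>powr_half_sum_squares_ge\<close>.\<close>
  define G where "G y = A powr q + q * \<rho> * c * A powr (q - 2) * y
    + q / 2 * A powr (q - 2) * B\<^sup>2 * y\<^sup>2 + B powr q * \<bar>y\<bar> powr q" for y
  \<comment> \<open>The bound on \<rho> is used twice: \<rho>^2 \<le> (2q)^(-3) reduces the
    coefficient 4q^4 to q/2, and \<rho>^q \<le> (2q)^(-1.5q) cancels the constant of the
    remainder.\<close>
  have "\<rho> powr 2 \<le> ((2 * q) powr (- 1.5)) powr 2"
    using \<rho> by (intro powr_mono2) auto
  also have "\<dots> = (2 * q) powr (- 3)"
    by (simp only: powr_powr) simp
  also have "\<dots> = inverse ((2 * q) ^ 3)"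
    using q by (simp add: powr_minus powr_numeral)
  finally have "\<rho>\<^sup>2 \<le> inverse ((2 * q) ^ 3)" using \<rho> by simp
  then have "4 * q ^ 4 * \<rho>\<^sup>2 \<le> 4 * q ^ 4 * inverse ((2 * q) ^ 3)"
    using q by (intro mult_left_mono) auto
  also have "\<dots> = q / 2" using q by (simp add: field_simps power4_eq_xxxx power3_eq_cube)
  finally have \<rho>2: "4 * q ^ 4 * \<rho>\<^sup>2 \<le> q / 2" .
  have "\<rho> powr q \<le> ((2 * q) powr (- 1.5)) powr q"
    using q \<rho> by (intro powr_mono2) auto
  also have "\<dots> = inverse ((2 * q) powr (1.5 * q))"
    by (simp only: powr_powr powr_minus[symmetric]) simp
  finally have "(2 * q) powr (1.5 * q) * \<rho> powr q \<le> (2 * q) powr (1.5 * q) * inverse ((2 * q) powr (1.5 * q))"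
    by (intro mult_left_mono) auto
  also have "\<dots> = 1" using q by simp
  finally have \<rho>q: "(2 * q) powr (1.5 * q) * \<rho> powr q \<le> 1" .
  have W: "(A\<^sup>2 + 2 * (\<rho> * y * c) + (\<rho> * y * B)\<^sup>2) powr (q / 2) \<le> G y" for y
  proof -
    \<comment> \<open>The expansion is applied to the length \<rho> |y| B and the inner product
      \<rho> y c. The sign of y survives only in the latter, which keeps the linear term odd in
      y.\<close>
    have "\<bar>\<rho> * y * c\<bar> = (\<rho> * \<bar>y\<bar>) * \<bar>c\<bar>" using \<rho> by (simp add: abs_mult)
    also have "\<dots> \<le> (\<rho> * \<bar>y\<bar>) * (A * B)" using c \<rho> by (intro mult_left_mono) auto
    finally have "\<bar>\<rho> * y * c\<bar> \<le> A * (\<rho> * \<bar>y\<bar> * B)" by (simp add: mult_ac)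
    from powr_half_expansion_le[OF q A _ this]
    have "(A\<^sup>2 + 2 * (\<rho> * y * c) + (\<rho> * y * B)\<^sup>2) powr (q / 2)
      \<le> A powr q + q * (\<rho> * y * c) * A powr (q - 2)
        + 4 * q ^ 4 * (\<rho> * \<bar>y\<bar> * B)\<^sup>2 * A powr (q - 2)
        + (2 * q) powr (1.5 * q) * (\<rho> * \<bar>y\<bar> * B) powr q"
      using \<rho> B by (simp add: power_mult_distrib)
    also have "4 * q ^ 4 * (\<rho> * \<bar>y\<bar> * B)\<^sup>2 * A powr (q - 2)
      = 4 * q ^ 4 * \<rho>\<^sup>2 * (A powr (q - 2) * B\<^sup>2 * y\<^sup>2)"
      by (simp add: power_mult_distrib mult_ac)
    also have "\<dots> \<le> q / 2 * (A powr (q - 2) * B\<^sup>2 * y\<^sup>2)"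
      using \<rho>2 by (intro mult_right_mono) auto
    also have "(2 * q) powr (1.5 * q) * (\<rho> * \<bar>y\<bar> * B) powr q
      = (2 * q) powr (1.5 * q) * \<rho> powr q * (B powr q * \<bar>y\<bar> powr q)"
      using \<rho> B by (simp add: powr_mult mult_ac)
    also have "\<dots> \<le> 1 * (B powr q * \<bar>y\<bar> powr q)"
      using \<rho>q by (intro mult_right_mono) auto
    finally show ?thesis by (simp add: G_def mult_ac)
  qed
  have G0: "0 \<le> G y" for y using W[of y] powr_ge_zero order_trans by blast
  have G_int: "integrable N G"
    unfolding G_def using mean variance moment by simp
  have "(\<integral>\<^sup>+ y. ennreal ((A\<^sup>2 + 2 * (\<rho> * y * c) + (\<rho> * y * B)\<^sup>2) powr (q / 2)) \<partial>N)
    \<le> (\<integral>\<^sup>+ y. ennreal (G y) \<partial>N)"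
    using W by (intro nn_integral_mono ennreal_leI)
  also have "\<dots> = ennreal (LINT y|N. G y)"
    using G_int G0 by (intro nn_integral_eq_integral) auto
  also have "(LINT y|N. G y) = A powr q + q / 2 * A powr (q - 2) * B\<^sup>2
      + (LINT y|N. \<bar>y\<bar> powr q) * B powr q"
    unfolding G_def using mean variance moment by (simp add: prob_space)
  also have "ennreal \<dots> \<le> ennreal ((A\<^sup>2 + B\<^sup>2) powr (q / 2) + (LINT y|N. \<bar>y\<bar> powr q) * B powr q)"
    using powr_half_sum_squares_ge[OF q A, of B] by (intro ennreal_leI) auto
  finally show ?thesis .
qed

section \<open>Splitting off one variable\<close>

lemma sum_Pow_insert:
  assumes "finite I" "i \<notin> I"
  shows "(\<Sum>S\<in>Pow (insert i I). f S) = (\<Sum>S\<in>Pow I. f S) + (\<Sum>S\<in>Pow I. f (insert i S))"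
proof -
  have "inj_on (insert i) (Pow I)" using assms(2) by (auto simp: inj_on_def)
  moreover have "Pow I \<inter> insert i ` Pow I = {}" using assms(2) by auto
  ultimately show ?thesis
    using assms(1) by (simp add: Pow_insert sum.union_disjoint sum.reindex)
qed

lemma T_op_insert:
  assumes "finite I" "i \<notin> I"
  shows "T_op (insert i I) Z \<rho> a x
    = T_op I Z \<rho> a x + \<rho> * Z i x * T_op I Z \<rho> (\<lambda>S. a (insert i S)) x"
proof -
  have "\<rho> ^ card (insert i S) * a (insert i S) * (\<Prod>j\<in>insert i S. Z j x)
    = \<rho> * Z i x * (\<rho> ^ card S * a (insert i S) * (\<Prod>j\<in>S. Z j x))" if "S \<in> Pow I" for S
  proof -
    have "finite S" "i \<notin> S" using that assms finite_subset by auto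
    then show ?thesis by (simp add: mult_ac)
  qed
  then have "(\<Sum>S\<in>Pow I. \<rho> ^ card (insert i S) * a (insert i S) * (\<Prod>j\<in>insert i S. Z j x))
    = \<rho> * Z i x * (\<Sum>S\<in>Pow I. \<rho> ^ card S * a (insert i S) * (\<Prod>j\<in>S. Z j x))"
    unfolding sum_distrib_left by (rule sum.cong[OF refl])
  then show ?thesis
    unfolding T_op_def multilin_def sum_Pow_insert[OF assms] by simp
qed

lemma T_op_cong:
  assumes "\<And>i. i \<in> I \<Longrightarrow> Z i x = Y i y"
  shows "T_op I Z \<rho> a x = T_op I Y \<rho> a y"
  unfolding T_op_def multilin_def using assms
  by (intro sum.cong refl arg_cong2[where f = "(*)"] prod.cong) auto

lemma measurable_T_op [measurable]:
  assumes "\<And>i. sets (N i) = sets borel"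
  shows "T_op I (\<lambda>i x. x i) \<rho> a \<in> borel_measurable (PiM I N)"
  unfolding T_op_def multilin_def
proof (intro borel_measurable_sum borel_measurable_times borel_measurable_const borel_measurable_prod)
  fix S i assume "S \<in> Pow I" "i \<in> S"
  then have "(\<lambda>x. x i) \<in> measurable (PiM I N) (N i)" by (intro measurable_component_singleton) auto
  then show "(\<lambda>x. x i) \<in> borel_measurable (PiM I N)"
    using measurable_cong_sets[OF refl assms] by blast
qed

text \<open>The squared 2-norm of \<open>D_op I Z S a\<close> when the monomials are orthonormal,
  expressed by coefficients alone. Summing over all of \<open>Pow I\<close> makes
  \<open>sum_Pow_insert\<close> applicable.\<close>

definition tail_weight :: "'i set \<Rightarrow> ('i set \<Rightarrow> real) \<Rightarrow> 'i set \<Rightarrow> real" where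
  "tail_weight I a S = (\<Sum>U\<in>Pow I. if S \<subseteq> U then (a U)\<^sup>2 else 0)"

text \<open>Sort the supersets by whether they contain \<open>i\<close>: both kinds occur above
  \<open>S\<close>, only one above \<open>insert i S\<close>.\<close>

lemma tail_weight_insert:
  assumes "finite I" "i \<notin> I" "S \<subseteq> I"
  shows "tail_weight (insert i I) a S = tail_weight I a S + tail_weight I (\<lambda>U. a (insert i U)) S"
    and "tail_weight (insert i I) a (insert i S) = tail_weight I (\<lambda>U. a (insert i U)) S"
proof -
  have "S \<subseteq> insert i U \<longleftrightarrow> S \<subseteq> U" for U using assms(2,3) by auto
  then show "tail_weight (insert i I) a S = tail_weight I a S + tail_weight I (\<lambda>U. a (insert i U)) S"
    unfolding tail_weight_def sum_Pow_insert[OF assms(1,2)] by simp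
  have "(\<Sum>U\<in>Pow I. if insert i S \<subseteq> U then (a U)\<^sup>2 else 0) = 0"
    using assms(2) by (intro sum.neutral) auto
  moreover have "insert i S \<subseteq> insert i U \<longleftrightarrow> S \<subseteq> U" for U using assms(2,3) by auto
  ultimately show "tail_weight (insert i I) a (insert i S) = tail_weight I (\<lambda>U. a (insert i U)) S"
    unfolding tail_weight_def sum_Pow_insert[OF assms(1,2)] by simp
qed

section \<open>Tensorization by induction on the index set\<close>

text \<open>Cauchy-Schwarz in coordinates; it supplies the condition on \<open>c\<close> in the
  one-variable inequality.\<close>

lemma abs_sum_list_mult_le:
  fixes f g :: "'a \<Rightarrow> real"
  shows "\<bar>\<Sum>c\<leftarrow>cs. f c * g c\<bar> \<le> sqrt (\<Sum>c\<leftarrow>cs. (f c)\<^sup>2) * sqrt (\<Sum>c\<leftarrow>cs. (g c)\<^sup>2)"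
proof -
  have "(\<Sum>c\<leftarrow>cs. f c * g c)\<^sup>2 \<le> (\<Sum>c\<leftarrow>cs. (f c)\<^sup>2) * (\<Sum>c\<leftarrow>cs. (g c)\<^sup>2)"
    using Cauchy_Schwarz_ineq_sum[of "\<lambda>k. f (cs ! k)" "\<lambda>k. g (cs ! k)" "{0..<length cs}"]
    by (simp add: sum_list_sum_nth)
  then show ?thesis by (metis real_sqrt_abs real_sqrt_le_iff real_sqrt_mult)
qed

text \<open>The list encodes a vector-valued coefficient family by its coordinates.\<close>
lemma nn_integral_T_op_le:
  fixes N :: "'i \<Rightarrow> real measure" and cs :: "('i set \<Rightarrow> real) list"
  assumes N: "\<And>i. prob_space (N i)" "\<And>i. sets (N i) = sets borel"
    and q: "2 \<le> q" and \<rho>: "0 \<le> \<rho>" "\<rho> \<le> (2 * q) powr (- 1.5)"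
    and "finite I"
    and "\<And>i. i \<in> I \<Longrightarrow> integrable (N i) (\<lambda>y. y)"
    and "\<And>i. i \<in> I \<Longrightarrow> (LINT y|N i. y) = 0"
    and "\<And>i. i \<in> I \<Longrightarrow> integrable (N i) (\<lambda>y. y\<^sup>2)"
    and "\<And>i. i \<in> I \<Longrightarrow> (LINT y|N i. y\<^sup>2) = 1"
    and "\<And>i. i \<in> I \<Longrightarrow> integrable (N i) (\<lambda>y. \<bar>y\<bar> powr q)"
  shows "(\<integral>\<^sup>+ x. ennreal ((\<Sum>c\<leftarrow>cs. (T_op I (\<lambda>i x. x i) \<rho> c x)\<^sup>2) powr (q / 2)) \<partial>PiM I N)
    \<le> ennreal (\<Sum>S\<in>Pow I. (\<Prod>i\<in>S. LINT y|N i. \<bar>y\<bar> powr q)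
        * (\<Sum>c\<leftarrow>cs. tail_weight I c S) powr (q / 2))"
  using assms(6-11)
proof (induction I arbitrary: cs rule: finite_induct)
  case empty
  interpret product_prob_space N by (rule product_prob_spaceI) (rule N(1))
  show ?case
    by (subst nn_integral_empty) (simp_all add: T_op_def multilin_def tail_weight_def)
next
  case (insert i I)
  interpret product_prob_space N by (rule product_prob_spaceI) (rule N(1))
  define P where "P = T_op I (\<lambda>i x. x i) \<rho>"
  define m where "m = (\<lambda>i. LINT y|N i. \<bar>y\<bar> powr q)"
  \<comment> \<open>The coefficients of the factor multiplying the variable \<open>i\<close>,
    coordinate by coordinate: the vector e, while \<open>cs\<close> itself gives d.\<close>
  define D where "D = map (\<lambda>c S. c (insert i S)) cs"
  have [measurable]: "P c \<in> borel_measurable (PiM I N)" for c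
    unfolding P_def by (rule measurable_T_op) (rule N)
  have m0: "0 \<le> m j" for j unfolding m_def by (intro integral_nonneg_AE) auto
  have [measurable]: "T_op (insert i I) (\<lambda>i x. x i) \<rho> c \<in> borel_measurable (PiM (insert i I) N)" for c
    by (rule measurable_T_op) (rule N)
  have [measurable]: "(\<lambda>x. \<Sum>c\<leftarrow>cs. (P c x)\<^sup>2) \<in> borel_measurable (PiM I N)" for cs
    unfolding sum_list_sum_nth by simp
  have P0: "0 \<le> (\<Sum>c\<leftarrow>cs. (P c x)\<^sup>2)" for cs x
    by (intro sum_list_nonneg) auto
  \<comment> \<open>With the other variables frozen at \<open>x\<close>, the one-variable inequality
    applies. Its |d|^2 + |e|^2 is the squared length of the concatenation \<open>cs @ D\<close>,
    again of the form covered by the induction hypothesis.\<close>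
  have step: "(\<integral>\<^sup>+ y. ennreal ((\<Sum>c\<leftarrow>cs. (T_op (insert i I) (\<lambda>i x. x i) \<rho> c (x(i := y)))\<^sup>2) powr (q / 2)) \<partial>N i)
    \<le> ennreal ((\<Sum>c\<leftarrow>cs @ D. (P c x)\<^sup>2) powr (q / 2)) + ennreal (m i) * ennreal ((\<Sum>c\<leftarrow>D. (P c x)\<^sup>2) powr (q / 2))"
    for x
  proof -
    define A where "A = sqrt (\<Sum>c\<leftarrow>cs. (P c x)\<^sup>2)"
    define B where "B = sqrt (\<Sum>c\<leftarrow>D. (P c x)\<^sup>2)"
    define r where "r = (\<Sum>c\<leftarrow>cs. P c x * P (\<lambda>S. c (insert i S)) x)"
    have r: "\<bar>r\<bar> \<le> A * B"
      unfolding r_def A_def B_def using abs_sum_list_mult_le by (simp add: D_def comp_def)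
    have A2: "A\<^sup>2 = (\<Sum>c\<leftarrow>cs. (P c x)\<^sup>2)" and B2: "B\<^sup>2 = (\<Sum>c\<leftarrow>D. (P c x)\<^sup>2)"
      unfolding A_def B_def by (simp_all only: real_sqrt_pow2 P0)
    have A0: "0 \<le> A" and B0: "0 \<le> B" unfolding A_def B_def by (simp_all only: real_sqrt_ge_zero P0)
    have Bq: "B powr q = (B\<^sup>2) powr (q / 2)"
      using B0 q by (cases "B = 0") (simp_all add: powr_powr flip: powr_numeral)
    have T: "T_op (insert i I) (\<lambda>i x. x i) \<rho> c (x(i := y)) = P c x + \<rho> * y * P (\<lambda>S. c (insert i S)) x" for c y
    proof -
      have "T_op I (\<lambda>i x. x i) \<rho> a (x(i := y)) = P a x" for a
        unfolding P_def using insert.hyps(2) by (intro T_op_cong) auto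
      then show ?thesis by (simp add: T_op_insert[OF insert.hyps])
    qed
    have "(\<Sum>c\<leftarrow>cs. (T_op (insert i I) (\<lambda>i x. x i) \<rho> c (x(i := y)))\<^sup>2)
      = A\<^sup>2 + 2 * (\<rho> * y * r) + (\<rho> * y * B)\<^sup>2" for y
      unfolding A2 B2 power_mult_distrib r_def T
      by (simp add: D_def comp_def power2_sum sum_list_addf sum_list_const_mult[symmetric] power_mult_distrib mult_ac)
    then have "(\<integral>\<^sup>+ y. ennreal ((\<Sum>c\<leftarrow>cs. (T_op (insert i I) (\<lambda>i x. x i) \<rho> c (x(i := y)))\<^sup>2) powr (q / 2)) \<partial>N i)
      \<le> ennreal ((A\<^sup>2 + B\<^sup>2) powr (q / 2) + m i * B powr q)"
      unfolding m_def
      using nn_integral_noise_le[OF N(1,2) q \<rho> _ _ _ _ _ A0 B0 r] insert.prems by simp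
    also have "\<dots> = ennreal ((\<Sum>c\<leftarrow>cs @ D. (P c x)\<^sup>2) powr (q / 2)) + ennreal (m i) * ennreal ((\<Sum>c\<leftarrow>D. (P c x)\<^sup>2) powr (q / 2))"
      unfolding Bq A2 B2 using m0 by (simp add: ennreal_mult)
    finally show ?thesis .
  qed
  have IH: "(\<integral>\<^sup>+ x. ennreal ((\<Sum>c\<leftarrow>cs. (P c x)\<^sup>2) powr (q / 2)) \<partial>PiM I N)
    \<le> ennreal (\<Sum>S\<in>Pow I. (\<Prod>i\<in>S. m i) * (\<Sum>c\<leftarrow>cs. tail_weight I c S) powr (q / 2))" for cs
    unfolding P_def m_def using insert.IH insert.prems by simp
  have "(\<integral>\<^sup>+ x. ennreal ((\<Sum>c\<leftarrow>cs. (T_op (insert i I) (\<lambda>i x. x i) \<rho> c x)\<^sup>2) powr (q / 2)) \<partial>PiM (insert i I) N)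
    = (\<integral>\<^sup>+ x. (\<integral>\<^sup>+ y. ennreal ((\<Sum>c\<leftarrow>cs. (T_op (insert i I) (\<lambda>i x. x i) \<rho> c (x(i := y)))\<^sup>2) powr (q / 2)) \<partial>N i) \<partial>PiM I N)"
    by (intro product_nn_integral_insert insert.hyps) (simp add: sum_list_sum_nth)
  also have "\<dots> \<le> (\<integral>\<^sup>+ x. ennreal ((\<Sum>c\<leftarrow>cs @ D. (P c x)\<^sup>2) powr (q / 2)) + ennreal (m i) * ennreal ((\<Sum>c\<leftarrow>D. (P c x)\<^sup>2) powr (q / 2)) \<partial>PiM I N)"
    by (intro nn_integral_mono step)
  also have "\<dots> = (\<integral>\<^sup>+ x. ennreal ((\<Sum>c\<leftarrow>cs @ D. (P c x)\<^sup>2) powr (q / 2)) \<partial>PiM I N)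
    + ennreal (m i) * (\<integral>\<^sup>+ x. ennreal ((\<Sum>c\<leftarrow>D. (P c x)\<^sup>2) powr (q / 2)) \<partial>PiM I N)"
    by (simp add: nn_integral_add nn_integral_cmult del: map_append sum_list_append)
  also have "\<dots> \<le> ennreal (\<Sum>S\<in>Pow I. (\<Prod>i\<in>S. m i) * (\<Sum>c\<leftarrow>cs @ D. tail_weight I c S) powr (q / 2))
    + ennreal (m i) * ennreal (\<Sum>S\<in>Pow I. (\<Prod>i\<in>S. m i) * (\<Sum>c\<leftarrow>D. tail_weight I c S) powr (q / 2))"
    by (intro add_mono mult_left_mono IH) auto
  also have "\<dots> = ennreal ((\<Sum>S\<in>Pow I. (\<Prod>i\<in>S. m i) * (\<Sum>c\<leftarrow>cs @ D. tail_weight I c S) powr (q / 2))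
    + m i * (\<Sum>S\<in>Pow I. (\<Prod>i\<in>S. m i) * (\<Sum>c\<leftarrow>D. tail_weight I c S) powr (q / 2)))"
    using m0 by (simp add: ennreal_mult ennreal_plus sum_nonneg prod_nonneg)
  \<comment> \<open>The list \<open>cs @ D\<close> yields the summands for sets without
    \<open>i\<close>; next, \<open>D\<close> with the factor \<open>m i\<close> yields those for
    sets containing \<open>i\<close>.\<close>
  also have "(\<Sum>S\<in>Pow I. (\<Prod>i\<in>S. m i) * (\<Sum>c\<leftarrow>cs @ D. tail_weight I c S) powr (q / 2))
    = (\<Sum>S\<in>Pow I. (\<Prod>i\<in>S. m i) * (\<Sum>c\<leftarrow>cs. tail_weight (insert i I) c S) powr (q / 2))"
    using tail_weight_insert(1)[OF insert.hyps]
    by (intro sum.cong refl) (simp add: D_def comp_def sum_list_addf)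
  also have "m i * (\<Sum>S\<in>Pow I. (\<Prod>i\<in>S. m i) * (\<Sum>c\<leftarrow>D. tail_weight I c S) powr (q / 2))
    = (\<Sum>S\<in>Pow I. (\<Prod>i\<in>insert i S. m i) * (\<Sum>c\<leftarrow>cs. tail_weight (insert i I) c (insert i S)) powr (q / 2))"
    unfolding sum_distrib_left
  proof (intro sum.cong refl)
    fix S assume S: "S \<in> Pow I"
    then have "finite S" "i \<notin> S" using insert.hyps finite_subset by auto
    then show "m i * ((\<Prod>i\<in>S. m i) * (\<Sum>c\<leftarrow>D. tail_weight I c S) powr (q / 2))
      = (\<Prod>i\<in>insert i S. m i) * (\<Sum>c\<leftarrow>cs. tail_weight (insert i I) c (insert i S)) powr (q / 2)"
      using S tail_weight_insert(2)[OF insert.hyps] by (simp add: D_def comp_def mult_ac)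
  qed
  finally show ?case
    unfolding m_def sum_Pow_insert[OF insert.hyps] .
qed

section \<open>Orthonormality of the monomials\<close>

text \<open>The product has the factor Z_i^2 on the intersection of U and V, Z_i on the symmetric
  difference and 1 elsewhere. By independence the expectation factors, and one index in the
  symmetric difference makes it 0.\<close>

lemma (in prob_space) expectation_prod_mult_prod:
  fixes Z :: "'i \<Rightarrow> 'a \<Rightarrow> real"
  assumes I: "finite I" "indep_vars (\<lambda>_. borel) Z I"
    and mean: "\<And>i. i \<in> I \<Longrightarrow> integrable M (Z i)" "\<And>i. i \<in> I \<Longrightarrow> expectation (Z i) = 0"
    and variance: "\<And>i. i \<in> I \<Longrightarrow> integrable M (\<lambda>x. (Z i x)\<^sup>2)"
      "\<And>i. i \<in> I \<Longrightarrow> expectation (\<lambda>x. (Z i x)\<^sup>2) = 1"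
    and UV: "U \<subseteq> I" "V \<subseteq> I"
  shows "integrable M (\<lambda>x. (\<Prod>i\<in>U. Z i x) * (\<Prod>i\<in>V. Z i x))"
    and "expectation (\<lambda>x. (\<Prod>i\<in>U. Z i x) * (\<Prod>i\<in>V. Z i x)) = (if U = V then 1 else 0)"
proof -
  define h where "h i y = (if i \<in> U then y else 1) * (if i \<in> V then y else 1 :: real)" for i y
  have prod_eq: "(\<Prod>i\<in>U. Z i x) * (\<Prod>i\<in>V. Z i x) = (\<Prod>i\<in>I. h i (Z i x))" for x
    using I(1) UV by (simp add: h_def prod.distrib prod.If_cases Int_absorb1)
  have indep: "indep_vars (\<lambda>_. borel) (\<lambda>i x. h i (Z i x)) I"
    by (rule indep_vars_compose2[OF I(2)]) (simp add: h_def)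
  have h: "h i (Z i x) = (if i \<in> U \<and> i \<in> V then (Z i x)\<^sup>2 else if i \<in> U \<or> i \<in> V then Z i x else 1)" for i x
    by (simp add: h_def power2_eq_square)
  have h_int: "integrable M (\<lambda>x. h i (Z i x))" if "i \<in> I" for i
    unfolding h using mean(1) variance(1) that
    by (cases "i \<in> U"; cases "i \<in> V") simp_all
  have h_exp: "expectation (\<lambda>x. h i (Z i x)) = (if i \<in> U \<longleftrightarrow> i \<in> V then 1 else 0)" if "i \<in> I" for i
    unfolding h using mean(2) variance(2) that
    by (cases "i \<in> U"; cases "i \<in> V") (simp_all add: prob_space)
  show "integrable M (\<lambda>x. (\<Prod>i\<in>U. Z i x) * (\<Prod>i\<in>V. Z i x))"
    unfolding prod_eq by (intro indep_vars_integrable I indep h_int)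
  have "expectation (\<lambda>x. (\<Prod>i\<in>U. Z i x) * (\<Prod>i\<in>V. Z i x)) = (\<Prod>i\<in>I. if i \<in> U \<longleftrightarrow> i \<in> V then 1 else 0)"
    unfolding prod_eq using indep_vars_lebesgue_integral[OF I(1) indep h_int] h_exp by simp
  also have "\<dots> = (if U = V then 1 else 0)"
    using I(1) UV by (auto simp: prod_zero_iff)
  finally show "expectation (\<lambda>x. (\<Prod>i\<in>U. Z i x) * (\<Prod>i\<in>V. Z i x)) = (if U = V then 1 else 0)" .
qed

text \<open>Expand the square into a double sum. Removing S is injective on supersets of S, so by
  orthonormality only the diagonal remains.\<close>

lemma (in prob_space) expectation_D_op_power2:
  fixes Z :: "'i \<Rightarrow> 'a \<Rightarrow> real"
  assumes I: "finite I" "indep_vars (\<lambda>_. borel) Z I"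
    and mean: "\<And>i. i \<in> I \<Longrightarrow> integrable M (Z i)" "\<And>i. i \<in> I \<Longrightarrow> expectation (Z i) = 0"
    and variance: "\<And>i. i \<in> I \<Longrightarrow> integrable M (\<lambda>x. (Z i x)\<^sup>2)"
      "\<And>i. i \<in> I \<Longrightarrow> expectation (\<lambda>x. (Z i x)\<^sup>2) = 1"
  shows "expectation (\<lambda>x. (D_op I Z S a x)\<^sup>2) = tail_weight I a S"
proof -
  define \<U> where "\<U> = {U. S \<subseteq> U \<and> U \<subseteq> I}"
  have fin: "finite \<U>" unfolding \<U>_def using I(1) by auto
  have sub: "U - S \<subseteq> I" if "U \<in> \<U>" for U using that by (auto simp: \<U>_def)
  note orth = expectation_prod_mult_prod[OF I mean variance]
  have "(D_op I Z S a x)\<^sup>2 = (\<Sum>U\<in>\<U>. \<Sum>V\<in>\<U>. a U * a V * ((\<Prod>i\<in>U - S. Z i x) * (\<Prod>i\<in>V - S. Z i x)))" for x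
    unfolding D_op_def \<U>_def[symmetric] power2_eq_square sum_product by (simp add: mult_ac)
  then have "expectation (\<lambda>x. (D_op I Z S a x)\<^sup>2)
    = (\<Sum>U\<in>\<U>. \<Sum>V\<in>\<U>. a U * a V * expectation (\<lambda>x. (\<Prod>i\<in>U - S. Z i x) * (\<Prod>i\<in>V - S. Z i x)))"
    using orth(1) sub by (simp add: Bochner_Integration.integral_sum Bochner_Integration.integrable_sum)
  also have "\<dots> = (\<Sum>U\<in>\<U>. \<Sum>V\<in>\<U>. if V = U then (a U)\<^sup>2 else 0)"
  proof (intro sum.cong refl)
    fix U V assume UV: "U \<in> \<U>" "V \<in> \<U>"
    then have "U - S \<subseteq> I" "V - S \<subseteq> I" "U - S = V - S \<longleftrightarrow> V = U" by (auto simp: \<U>_def)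
    then show "a U * a V * expectation (\<lambda>x. (\<Prod>i\<in>U - S. Z i x) * (\<Prod>i\<in>V - S. Z i x))
      = (if V = U then (a U)\<^sup>2 else 0)"
      by (simp add: orth(2) power2_eq_square)
  qed
  also have "\<dots> = (\<Sum>U\<in>\<U>. (a U)\<^sup>2)" using fin by simp
  also have "\<dots> = tail_weight I a S"
    unfolding tail_weight_def \<U>_def using I(1) by (simp add: sum.inter_filter[symmetric] Pow_def conj_commute)
  finally show ?thesis .
qed

section \<open>Transfer from the product space to the given random variables\<close>

text \<open>Independence says that the joint law is the product of the marginals. The criterion used
  concerns nonempty families; for the empty one both sides are the value of \<open>f\<close> at a
  single point.\<close>

lemma (in prob_space) nn_integral_indep_vars_PiM:
  fixes Z :: "'i \<Rightarrow> 'a \<Rightarrow> real"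
  assumes I: "finite I" "indep_vars (\<lambda>_. borel) Z I"
    and f: "f \<in> borel_measurable (PiM I (\<lambda>_. borel))"
  shows "(\<integral>\<^sup>+ x. f (\<lambda>i\<in>I. Z i x) \<partial>M) = (\<integral>\<^sup>+ x. f x \<partial>PiM I (\<lambda>i. distr M borel (Z i)))"
proof (cases "I = {}")
  case True
  then show ?thesis
    by (simp add: PiM_empty nn_integral_count_space_finite emeasure_space_1 restrict_def)
next
  case False
  have rv [measurable]: "random_variable borel (Z i)" if "i \<in> I" for i
    using I(2) that by (auto simp: indep_vars_def)
  have "(\<lambda>x. \<lambda>i\<in>I. Z i x) \<in> measurable M (PiM I (\<lambda>_. borel))"
    by (intro measurable_restrict rv)
  moreover have "distr M (PiM I (\<lambda>_. borel)) (\<lambda>x. \<lambda>i\<in>I. Z i x) = PiM I (\<lambda>i. distr M borel (Z i))"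
    using indep_vars_iff_distr_eq_PiM'[of I Z "\<lambda>_. borel", OF False rv] I(2) by blast
  ultimately show ?thesis
    using f nn_integral_distr[of "\<lambda>x. \<lambda>i\<in>I. Z i x" M "PiM I (\<lambda>_. borel)" f] by simp
qed

theorem theorem7p7:
  fixes M :: "'w measure"
    and n :: nat
    and Z :: "nat \<Rightarrow> 'w \<Rightarrow> real"
    and q \<rho> :: real
    and \<sigma> :: "nat \<Rightarrow> real"
    and a :: "nat set \<Rightarrow> real"
  assumes "prob_space M"
    and "q \<ge> 2"
    and "0 \<le> \<rho>" and "\<rho> \<le> (2 * q) powr (- 1.5)"
    and "prob_space.indep_vars M (\<lambda>_. borel) Z {1..n}"
    and "\<And>i. i \<in> {1..n} \<Longrightarrow> integrable M (Z i)"
    and "\<And>i. i \<in> {1..n} \<Longrightarrow> (LINT x|M. Z i x) = 0"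
    and "\<And>i. i \<in> {1..n} \<Longrightarrow> integrable M (\<lambda>x. (Z i x)\<^sup>2)"
    and "\<And>i. i \<in> {1..n} \<Longrightarrow> (LINT x|M. (Z i x)\<^sup>2) = 1"
    and "\<And>i. i \<in> {1..n} \<Longrightarrow> \<sigma> i > 0"
    and "\<And>i. i \<in> {1..n} \<Longrightarrow> integrable M (\<lambda>x. \<bar>Z i x\<bar> powr q)"
    and "\<And>i. i \<in> {1..n} \<Longrightarrow> (LINT x|M. \<bar>Z i x\<bar> powr q) = \<sigma> i powr (2 - q)"
  shows "Lr_norm M q (T_op {1..n} Z \<rho> a) powr q
    \<le> (\<Sum>S\<in>Pow {1..n}. (\<Prod>i\<in>S. \<sigma> i) powr (2 - q) * Lr_norm M 2 (D_op {1..n} Z S a) powr q)"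
proof -
  interpret prob_space M by fact
  define I where "I = {1..n}"
  note assms = assms[folded I_def]
  have fin: "finite I" by (simp add: I_def)
  have rv [measurable]: "random_variable borel (Z i)" if "i \<in> I" for i
    using assms(5) that by (auto simp: indep_vars_def)
  \<comment> \<open>The induction asks for a probability measure at every index, so outside
    \<open>I\<close> a point mass at 0 is put in.\<close>
  define N where "N i = distr M borel (if i \<in> I then Z i else (\<lambda>_. 0))" for i
  have N: "prob_space (N i)" "sets (N i) = sets borel" for i
    unfolding N_def by (auto intro!: prob_space_distr rv simp del: distr_const)
  have moment: "(LINT y|N i. \<bar>y\<bar> powr q) = \<sigma> i powr (2 - q)" if "i \<in> I" for i
    unfolding N_def using that assms(12) by (simp add: integral_distr)
  define K where "K = (\<Sum>S\<in>Pow I. (\<Prod>i\<in>S. LINT y|N i. \<bar>y\<bar> powr q) * tail_weight I a S powr (q / 2))"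
  have K0: "0 \<le> K" unfolding K_def by (intro sum_nonneg mult_nonneg_nonneg prod_nonneg) auto
  let ?F = "\<lambda>x. ennreal (\<bar>T_op I (\<lambda>i x. x i) \<rho> a x\<bar> powr q)"
  have F: "?F \<in> borel_measurable (PiM I (\<lambda>_. borel))"
  proof -
    have [measurable]: "T_op I (\<lambda>i x. x i) \<rho> a \<in> borel_measurable (PiM I (\<lambda>_. borel))"
      by (rule measurable_T_op) simp
    show ?thesis by measurable
  qed
  have "(\<integral>\<^sup>+ x. ennreal (\<bar>T_op I Z \<rho> a x\<bar> powr q) \<partial>M) = (\<integral>\<^sup>+ x. ?F (\<lambda>i\<in>I. Z i x) \<partial>M)"
    by (intro nn_integral_cong arg_cong[where f = "\<lambda>t. ennreal (\<bar>t\<bar> powr q)"] T_op_cong) simp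
  also have "\<dots> = (\<integral>\<^sup>+ x. ?F x \<partial>PiM I (\<lambda>i. distr M borel (Z i)))"
    by (rule nn_integral_indep_vars_PiM[OF fin assms(5) F])
  also have "PiM I (\<lambda>i. distr M borel (Z i)) = PiM I N"
    by (intro PiM_cong) (auto simp: N_def)
  \<comment> \<open>The scalar case is the vector-valued inequality with one coordinate, the list
    \<open>[a]\<close>.\<close>
  also have "(\<integral>\<^sup>+ x. ?F x \<partial>PiM I N)
    = (\<integral>\<^sup>+ x. ennreal ((\<Sum>c\<leftarrow>[a]. (T_op I (\<lambda>i x. x i) \<rho> c x)\<^sup>2) powr (q / 2)) \<partial>PiM I N)"
  proof -
    have "\<bar>t\<bar> powr q = (t\<^sup>2) powr (q / 2)" for t :: real
    proof (cases "t = 0")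
      case False
      then have "(\<bar>t\<bar> powr 2) powr (q / 2) = \<bar>t\<bar> powr q" by (simp only: powr_powr) simp
      then show ?thesis using False by simp
    qed simp
    then show ?thesis by simp
  qed
  also have "\<dots> \<le> ennreal (\<Sum>S\<in>Pow I. (\<Prod>i\<in>S. LINT y|N i. \<bar>y\<bar> powr q)
        * (\<Sum>c\<leftarrow>[a]. tail_weight I c S) powr (q / 2))"
    using assms by (intro nn_integral_T_op_le N fin) (simp_all add: N_def integral_distr integrable_distr_eq)
  also have "\<dots> = ennreal K" by (simp add: K_def)
  \<comment> \<open>A bound on the nonnegative integral by a real number carries over to the Bochner
    integral without a separate integrability proof.\<close>
  finally have "expectation (\<lambda>x. \<bar>T_op I Z \<rho> a x\<bar> powr q) \<le> K"
    using K0 by (intro integral_real_bounded) auto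
  moreover have "Lr_norm M q (T_op I Z \<rho> a) powr q = expectation (\<lambda>x. \<bar>T_op I Z \<rho> a x\<bar> powr q)"
    unfolding Lr_norm_def using assms(2) by (simp add: powr_powr)
  moreover have "K = (\<Sum>S\<in>Pow I. (\<Prod>i\<in>S. \<sigma> i) powr (2 - q) * Lr_norm M 2 (D_op I Z S a) powr q)"
    unfolding K_def
  proof (intro sum.cong refl arg_cong2[where f = "(*)"])
    fix S assume S: "S \<in> Pow I"
    have "(\<Prod>i\<in>S. LINT y|N i. \<bar>y\<bar> powr q) = (\<Prod>i\<in>S. \<sigma> i powr (2 - q))"
      using S moment by (intro prod.cong) auto
    also have "\<dots> = (\<Prod>i\<in>S. \<sigma> i) powr (2 - q)"
      by (rule prod_powr_distrib[symmetric])
    finally show "(\<Prod>i\<in>S. LINT y|N i. \<bar>y\<bar> powr q) = (\<Prod>i\<in>S. \<sigma> i) powr (2 - q)" .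
    show "tail_weight I a S powr (q / 2) = Lr_norm M 2 (D_op I Z S a) powr q"
      unfolding Lr_norm_def
      using expectation_D_op_power2[OF fin assms(5-9)] by (simp add: powr_powr)
  qed
  ultimately show ?thesis by (simp add: I_def)
qed

end
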